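(* Let $\mathcal{V}$ be a finite ground set, $k\ge2$ and $1\le\tau\le k$ integers with $|\mathcal{V}|\ge k$, $\mu_1,\mu_2,\alpha\in(0,1]$, and $h:\mathcal{H}(\mathcal{V})\to\mathbb{R}_{\ge 0}$ with $h(())=0$ forward-monotone. Let $S$ be the output of Algorithm 1 with parameters $k,\tau$, and $\mathrm{OPT}_\tau=\max_{S'\in\mathcal{H}(\mathcal{V}),|S'|\le k}\min_{\mathcal{V}'\subseteq\mathcal{V}(S'),|\mathcal{V}'|\le\tau}h(S'-\mathcal{V}')$. Let $\mathcal{Z}\subseteq\mathcal{V}(S)$ be any set of exactly $\tau$ elements occupying $\tau$ consecutive positions of $S$. (i) If $\tau<k$ and $h$ is backward-monotone, $\mu_1$-element-sequence-submodular and $\mu_2$-sequence-submodular, then $h(S-\mathcal{Z})\ge\frac{a\mu_2(e^b-1)}{(a+1)e^b-a\mu_2}\mathrm{OPT}_\tau$, where $a=\mu_1(1-1/e^{\mu_1})$ and $b=\mu_1\cdot\frac{k-2\tau}{k-\tau}$. (ii) If $h$ is $\alpha$-backward-monotone, $\mu_1$-element-sequence-submodular and $\mu_2$-sequence-submodular, then $h(S-\mathcal{Z})\ge\frac{\alpha^2\mu_1\mu_2(e^{\mu_1}-1)^2}{\mu_1e^{\mu_1}(e^{\mu_1}-1)+e^{2\mu_1}}\mathrm{OPT}_\tau$.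
   Context: $\mathcal{H}(\mathcal{V})$ denotes the set of all finite sequences of pairwise distinct elements of $\mathcal{V}$, including the empty sequence $()$. For $S\in\mathcal{H}(\mathcal{V})$, $\mathcal{V}(S)$ is the set of its elements and $|S|=|\mathcal{V}(S)|$. For a set $\mathcal{U}$, $S-\mathcal{U}$ is obtained from $S$ by deleting the elements of $\mathcal{U}$ keeping the order of the rest. For $S_1=(v_1,\dots,v_{m_1})$ and $S_2$ with $S_2-\mathcal{V}(S_1)=(w_1,\dots,w_{m_3})$, $S_1\oplus S_2=(v_1,\dots,v_{m_1},w_1,\dots,w_{m_3})$. $S_1\preceq S_2$ means $S_2=S_1\oplus S_3$ for some $S_3\in\mathcal{H}(\mathcal{V})$. $h(S_2\mid S_1)=h(S_1\oplus S_2)-h(S_1)$; $(v)$ is the one-element sequence. $h$ is forward-monotone if $h(S_1\oplus S_2)\ge h(S_1)$ for all $S_1,S_2$; backward-monotone if $h(S_1\oplus S_2)\ge h(S_2)$; $\alpha$-backward-monotone if $h(S_1\oplus S_2)\ge\alpha h(S_2)$ for all $S_1,S_2$; $\mu_1$-element-sequence-submodular if $h((v)\mid S_1)\ge\mu_1 h((v)\mid S_2)$ for all $v\in\mathcal{V}$ and all $S_1\preceq S_2$; $\mu_2$-sequence-submodular if $h(S_3\mid S_1)\ge\mu_2 h(S_3\mid S_2)$ for all $S_3$ and all $S_1\preceq S_2$. Algorithm 1 (parameters $k,\tau$): Step 1: from $S_1=()$, while $|S_1|<\tau$, append $v\in\arg\max_{v\in\mathcal{V}\setminus\mathcal{V}(S_1)}h((v)\mid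 S_1)$ to $S_1$. Step 2: from $S_2=()$, while $|S_2|<k-\tau$, append $v\in\arg\max_{v\in\mathcal{V}\setminus(\mathcal{V}(S_1)\cup\mathcal{V}(S_2))}h((v)\mid S_2)$ to $S_2$. Output $S=S_1\oplus S_2$; ties broken arbitrarily.
   Formalization: Part (i) additionally assumes that the denominator (a+1)e^b − aμ₂ is positive (automatic when 2τ ≤ k); when it is negative the stated bound fails, e.g. for h(S)=|S|, |V|=k=3, τ=2, μ₁=μ₂=1, and when it is zero the ratio is undefined. *)

theory Defs
  imports Complex_Main
begin

definition seqs :: "'a set \<Rightarrow> 'a list set" where
  "seqs V = {S. distinct S \<and> set S \<subseteq> V}"

definition seq_delete :: "'a list \<Rightarrow> 'a set \<Rightarrow> 'a list" where
  "seq_delete S U = filter (\<lambda>x. x \<notin> U) S"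

definition seq_plus :: "'a list \<Rightarrow> 'a list \<Rightarrow> 'a list" (infixl \<open>\<oplus>\<close> 65) where
  "S1 \<oplus> S2 = S1 @ seq_delete S2 (set S1)"

definition seq_preceq :: "'a set \<Rightarrow> 'a list \<Rightarrow> 'a list \<Rightarrow> bool" where
  "seq_preceq V S1 S2 \<longleftrightarrow> (\<exists>S3\<in>seqs V. S2 = S1 \<oplus> S3)"

text \<open>The marginal value written \<open>h(S2 | S1)\<close> on paper is \<open>marginal h S2 S1\<close>.\<close>

definition marginal :: "('a list \<Rightarrow> real) \<Rightarrow> 'a list \<Rightarrow> 'a list \<Rightarrow> real" where
  "marginal h S2 S1 = h (S1 \<oplus> S2) - h S1"

definition forward_monotone :: "'a set \<Rightarrow> ('a list \<Rightarrow> real) \<Rightarrow> bool" where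
  "forward_monotone V h \<longleftrightarrow>
     (\<forall>S1\<in>seqs V. \<forall>S2\<in>seqs V. h (S1 \<oplus> S2) \<ge> h S1)"

definition backward_monotone :: "'a set \<Rightarrow> ('a list \<Rightarrow> real) \<Rightarrow> bool" where
  "backward_monotone V h \<longleftrightarrow>
     (\<forall>S1\<in>seqs V. \<forall>S2\<in>seqs V. h (S1 \<oplus> S2) \<ge> h S2)"

definition approx_backward_monotone :: "'a set \<Rightarrow> ('a list \<Rightarrow> real) \<Rightarrow> real \<Rightarrow> bool" where
  "approx_backward_monotone V h \<alpha> \<longleftrightarrow>
     (\<forall>S1\<in>seqs V. \<forall>S2\<in>seqs V. h (S1 \<oplus> S2) \<ge> \<alpha> * h S2)"

definition element_sequence_submodular :: "'a set \<Rightarrow> ('a list \<Rightarrow> real) \<Rightarrow> real \<Rightarrow> bool" where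
  "element_sequence_submodular V h \<mu> \<longleftrightarrow>
     (\<forall>v\<in>V. \<forall>S1\<in>seqs V. \<forall>S2\<in>seqs V. seq_preceq V S1 S2 \<longrightarrow>
        marginal h [v] S1 \<ge> \<mu> * marginal h [v] S2)"

definition sequence_submodular :: "'a set \<Rightarrow> ('a list \<Rightarrow> real) \<Rightarrow> real \<Rightarrow> bool" where
  "sequence_submodular V h \<mu> \<longleftrightarrow>
     (\<forall>S3\<in>seqs V. \<forall>S1\<in>seqs V. \<forall>S2\<in>seqs V. seq_preceq V S1 S2 \<longrightarrow>
        marginal h S3 S1 \<ge> \<mu> * marginal h S3 S2)"

text \<open>
  The greedy loop that starts from the empty sequence and, while it has fewer than \<open>n\<close> elements,
  appends a maximiser of the marginal value among the elements of \<open>V\<close> outside \<open>U\<close> not yet used.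
  Arbitrary tie-breaking is modelled by a relation: \<open>greedy_state\<close> holds of every sequence that
  some choice of maximisers reaches, \<open>greedy_result\<close> of those on which the loop has stopped.
\<close>

inductive greedy_state :: "'a set \<Rightarrow> ('a list \<Rightarrow> real) \<Rightarrow> 'a set \<Rightarrow> nat \<Rightarrow> 'a list \<Rightarrow> bool"
  for V h U n where
  init: "greedy_state V h U n []"
| step: "greedy_state V h U n (S @ [v])"
    if "greedy_state V h U n S" and "length S < n"
      and "is_arg_max (\<lambda>v. marginal h [v] S) (\<lambda>v. v \<in> V - (U \<union> set S)) v"

definition greedy_result :: "'a set \<Rightarrow> ('a list \<Rightarrow> real) \<Rightarrow> 'a set \<Rightarrow> nat \<Rightarrow> 'a list \<Rightarrow> bool" where
  "greedy_result V h U n S \<longleftrightarrow> greedy_state V h U n S \<and> \<not> length S < n"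

definition algorithm_output ::
  "'a set \<Rightarrow> ('a list \<Rightarrow> real) \<Rightarrow> nat \<Rightarrow> nat \<Rightarrow> 'a list \<Rightarrow> bool" where
  "algorithm_output V h k \<tau> S \<longleftrightarrow>
     (\<exists>S1 S2. greedy_result V h {} \<tau> S1 \<and> greedy_result V h (set S1) (k - \<tau>) S2 \<and> S = S1 \<oplus> S2)"

definition robust_opt :: "'a set \<Rightarrow> ('a list \<Rightarrow> real) \<Rightarrow> nat \<Rightarrow> nat \<Rightarrow> real" where
  "robust_opt V h k \<tau> =
     Max {Min {h (seq_delete S V') |V'. V' \<subseteq> set S \<and> card V' \<le> \<tau>} |S. S \<in> seqs V \<and> length S \<le> k}"

definition consecutive_in :: "'a list \<Rightarrow> 'a set \<Rightarrow> bool" where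
  "consecutive_in S Z \<longleftrightarrow> (\<exists>i. i + card Z \<le> length S \<and> Z = (\<lambda>j. S ! j) ` {i..<i + card Z})"

end

theory Submission
  imports Defs
begin

text \<open>
  Let \<open>Z\<close> start at position \<open>i\<close> of \<open>S = S1 @ S2\<close>. What survives is \<open>P @ Q @ R\<close>, where \<open>P\<close> is the
  prefix of \<open>S1\<close> of length \<open>min i \<tau>\<close> and \<open>S2 = Q @ W @ R\<close> with \<open>W\<close> the deleted part of \<open>S2\<close>; the
  point is that \<open>W\<close> and \<open>P\<close> have the same length. As \<open>S1\<close> was chosen greedily from all of \<open>V\<close>,
  \<open>h P\<close> is at least a constant fraction of \<open>h W\<close>, so deleting \<open>W\<close> from \<open>S2\<close> costs at most a constant
  multiple of the surviving value. On the other hand an optimal sequence loses \<open>\<tau>\<close> elements in the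
  worst case, so some sequence of at most \<open>k - \<tau>\<close> elements disjoint from \<open>S1\<close> has value at
  least the robust optimum, and the greedy choice of \<open>S2\<close> competes with it.
\<close>

section \<open>Concatenation and deletion of duplicate-free sequences\<close>

lemma seq_plus_disjoint:
  assumes "set A \<inter> set B = {}"
  shows "A \<oplus> B = A @ B"
proof -
  have "filter (\<lambda>x. x \<notin> set A) B = B"
    using assms by (auto simp: filter_id_conv)
  then show ?thesis by (simp add: seq_plus_def seq_delete_def)
qed

lemma seq_plus_in_seqs: "A \<in> seqs V \<Longrightarrow> B \<in> seqs V \<Longrightarrow> A \<oplus> B \<in> seqs V"
  by (auto simp: seqs_def seq_plus_def seq_delete_def)

lemma seq_plus_snoc: "distinct (B @ [v]) \<Longrightarrow> A \<oplus> (B @ [v]) = (A \<oplus> B) \<oplus> [v]"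
  by (auto simp: seq_plus_def seq_delete_def)

lemma seq_plus_Nil [simp]: "A \<oplus> [] = A" "[] \<oplus> A = A"
  by (auto simp: seq_plus_def seq_delete_def)

lemma seq_delete_in_seqs: "A \<in> seqs V \<Longrightarrow> seq_delete A U \<in> seqs V"
  by (auto simp: seqs_def seq_delete_def)

lemma finite_seqs: "finite V \<Longrightarrow> finite (seqs V)"
  using finite_subset_distinct[of V] by (simp add: seqs_def conj_commute)

lemma greedy_state_seqs:
  assumes "greedy_state V h U n S"
  shows "S \<in> seqs V \<and> set S \<inter> U = {} \<and> length S \<le> n"
  using assms
  by induction (auto simp: seqs_def is_arg_max_def)

section \<open>Growth of the objective along a greedy run\<close>

text \<open>Serves both parts of the theorem: plain backward monotonicity is the case
  \<open>\<alpha> = 1\<close>. Submodularity is taken element-wise because a competitor is compared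
  with a greedy run by appending its elements one at a time.\<close>

locale monotone_objective =
  fixes V :: "'a set" and h :: "'a list \<Rightarrow> real" and \<mu> \<alpha> :: real
  assumes mu: "0 < \<mu>" "\<mu> \<le> 1" and alpha: "0 < \<alpha>" "\<alpha> \<le> 1"
    and nonneg: "T \<in> seqs V \<Longrightarrow> h T \<ge> 0" and h_Nil: "h [] = 0"
    and forward: "A \<in> seqs V \<Longrightarrow> B \<in> seqs V \<Longrightarrow> h A \<le> h (A \<oplus> B)"
    and backward: "A \<in> seqs V \<Longrightarrow> B \<in> seqs V \<Longrightarrow> \<alpha> * h B \<le> h (A \<oplus> B)"
    and element_submodular: "element_sequence_submodular V h \<mu>"
begin

text \<open>Maximality only speaks of elements outside the current prefix. An element already in the
  prefix has marginal value 0, and forward monotonicity makes the greedy gain nonnegative.\<close>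

lemma greedy_gain:
  assumes "greedy_state V h U n S" "i < length S" "v \<in> V - U"
  shows "marginal h [v] (take i S) \<le> h (take (Suc i) S) - h (take i S)"
  using assms
proof (induction arbitrary: i)
  case init
  then show ?case by simp
next
  case (step S w)
  show ?case
  proof (cases "i < length S")
    case True
    then show ?thesis using step by simp
  next
    case False
    with step.prems have i: "i = length S" by simp
    have S: "S \<in> seqs V" using greedy_state_seqs[OF step.hyps(1)] by simp
    have w: "w \<in> V" "w \<notin> set S" using step.hyps(3) by (auto simp: is_arg_max_def)
    have eq: "marginal h [w] S = h (S @ [w]) - h S"
      using w by (simp add: marginal_def seq_plus_disjoint)
    have pos: "marginal h [w] S \<ge> 0"
      using forward[OF S, of "[w]"] w by (simp add: marginal_def seqs_def)
    have "marginal h [v] S \<le> marginal h [w] S"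
    proof (cases "v \<in> set S")
      case True
      then have "S \<oplus> [v] = S" by (simp add: seq_plus_def seq_delete_def)
      then show ?thesis using pos by (simp add: marginal_def)
    next
      case False
      then have "v \<in> V - (U \<union> set S)" using step.prems(2) by auto
      then show ?thesis using step.hyps(3) by (auto simp: is_arg_max_linorder)
    qed
    then show ?thesis using i eq by simp
  qed
qed

text \<open>The elements of \<open>B\<close> are appended one by one; having \<open>A\<close>
  extended raises a marginal value by a factor of at most \<open>1 / \<mu>\<close>, and the gains
  telescope.\<close>

lemma seq_plus_le_elementwise:
  assumes A: "A \<in> seqs V" and "B \<in> seqs V"
    and gain: "\<And>v. v \<in> set B \<Longrightarrow> marginal h [v] A \<le> g"
  shows "h (A \<oplus> B) - h A \<le> real (length B) * g / \<mu>"
  using assms(2) gain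
proof (induction B rule: rev_induct)
  case Nil
  then show ?case by simp
next
  case (snoc v B)
  have B: "B \<in> seqs V" and v: "v \<in> V" and d: "distinct (B @ [v])"
    using snoc.prems(1) by (auto simp: seqs_def)
  have AB: "A \<oplus> B \<in> seqs V" using A B by (rule seq_plus_in_seqs)
  have "seq_preceq V A (A \<oplus> B)" using B by (auto simp: seq_preceq_def)
  then have "\<mu> * marginal h [v] (A \<oplus> B) \<le> marginal h [v] A"
    using element_submodular v A AB by (auto simp: element_sequence_submodular_def)
  also have "\<dots> \<le> g" using snoc.prems(2) by simp
  finally have "marginal h [v] (A \<oplus> B) \<le> g / \<mu>"
    using mu by (simp add: field_simps)
  then have "h (A \<oplus> (B @ [v])) - h (A \<oplus> B) \<le> g / \<mu>"
    by (simp add: marginal_def seq_plus_snoc[OF d])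
  moreover have "h (A \<oplus> B) - h A \<le> real (length B) * g / \<mu>"
    using snoc.IH[OF B] snoc.prems(2) by simp
  ultimately show ?case by (simp add: algebra_simps add_divide_distrib)
qed

text \<open>By backward monotonicity \<open>take j S \<oplus> T\<close> has value at least
  \<open>L\<close>, so a greedy step gains at least the fraction \<open>\<mu> / m\<close> of the gap
  between \<open>L\<close> and the current value, and the gap decays geometrically. The free start
  \<open>i\<close> allows use on the tail of a run.\<close>

lemma greedy_growth:
  assumes greedy: "greedy_state V h U n S" and T: "T \<in> seqs V" "set T \<inter> U = {}"
    and m: "length T \<le> m" "m \<ge> 1" and L: "L \<le> \<alpha> * h T"
    and ij: "i + d \<le> length S"
  shows "h (take (i + d) S) - h (take i S)
    \<ge> (1 - exp (- \<mu> * real d / real m)) * (L - h (take i S))"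
proof -
  have S: "S \<in> seqs V" using greedy_state_seqs[OF greedy] by simp
  have tS: "take j S \<in> seqs V" for j
    using S set_take_subset[of j S] by (auto simp: seqs_def)
  define r where "r = 1 - \<mu> / real m"
  have r: "0 \<le> r" using mu m by (simp add: r_def field_simps)
  have step: "L - h (take (Suc j) S) \<le> r * (L - h (take j S))" if j: "j < length S" for j
  proof -
    define g where "g = h (take (Suc j) S) - h (take j S)"
    have v: "S ! j \<in> V" "S ! j \<notin> set (take j S)"
      using S j distinct_take[of S "Suc j"] by (auto simp: seqs_def take_Suc_conv_app_nth)
    have "take (Suc j) S = take j S \<oplus> [S ! j]"
      using v j by (simp add: seq_plus_disjoint take_Suc_conv_app_nth)
    then have g0: "0 \<le> g"
      using forward[OF tS, of "[S ! j]" j] v by (simp add: g_def seqs_def)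
    have "h (take j S \<oplus> T) - h (take j S) \<le> real (length T) * g / \<mu>"
      using greedy_gain[OF greedy j] T
      by (intro seq_plus_le_elementwise tS) (auto simp: g_def seqs_def)
    also have "\<dots> \<le> real m * g / \<mu>"
      using m g0 mu by (intro divide_right_mono mult_right_mono) auto
    finally have "L - h (take j S) \<le> real m * g / \<mu>"
      using L backward[OF tS T(1), of j] by linarith
    then have "\<mu> / real m * (L - h (take j S)) \<le> g"
      using mu m by (simp add: field_simps)
    then show ?thesis by (simp add: r_def g_def algebra_simps)
  qed
  have decay: "L - h (take (i + d) S) \<le> r ^ d * (L - h (take i S))"
    using ij
  proof (induction d)
    case 0
    then show ?case by simp
  next
    case (Suc d)
    then have "L - h (take (Suc (i + d)) S) \<le> r * (L - h (take (i + d) S))"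
      by (intro step) simp
    also have "\<dots> \<le> r * (r ^ d * (L - h (take i S)))"
      using Suc r by (intro mult_left_mono) auto
    finally show ?case by (simp add: mult.assoc)
  qed
  have "r \<le> exp (- \<mu> / real m)"
    using exp_ge_add_one_self[of "- \<mu> / real m"] by (simp add: r_def)
  then have "r ^ d \<le> exp (- \<mu> / real m) ^ d"
    using r by (intro power_mono) auto
  also have "\<dots> = exp (- \<mu> * real d / real m)"
    by (simp add: exp_of_nat_mult[symmetric] mult.commute)
  finally have rd: "r ^ d \<le> exp (- \<mu> * real d / real m)" .
  show ?thesis
  \<comment> \<open>Multiplying a negative gap by the larger exponential instead of
    \<open>r ^ d\<close> would reverse the estimate. In that case the right-hand side is nonpositive
    and forward monotonicity is enough.\<close>
  proof (cases "L \<ge> h (take i S)")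
    case True
    then have "r ^ d * (L - h (take i S)) \<le> exp (- \<mu> * real d / real m) * (L - h (take i S))"
      using rd by (intro mult_right_mono) auto
    then show ?thesis using decay by (simp add: algebra_simps)
  next
    case False
    have d: "distinct S" using S by (simp add: seqs_def)
    have "take (i + d) S = take i S \<oplus> take d (drop i S)"
      using set_take_disj_set_drop_if_distinct[OF d, of i i] set_take_subset[of d "drop i S"]
      by (subst seq_plus_disjoint) (auto simp: take_add)
    moreover have "take d (drop i S) \<in> seqs V"
      using S set_take_subset[of d "drop i S"] set_drop_subset[of i S]
      by (auto simp: seqs_def)
    ultimately have "h (take i S) \<le> h (take (i + d) S)" using forward[OF tS] by simp
    moreover have "(1 - exp (- \<mu> * real d / real m)) * (L - h (take i S)) \<le> 0"
      using False mu by (intro mult_nonneg_nonpos) auto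
    ultimately show ?thesis by linarith
  qed
qed

end

section \<open>The robust optimum and a short competitor\<close>

text \<open>Maximum and minimum range over finite nonempty sets: \<open>[]\<close> is always a
  candidate sequence and \<open>{}\<close> a candidate deletion. So an optimal sequence exists, and
  the set to delete from it can be chosen afterwards.\<close>

lemma robust_opt_attained:
  assumes "finite V" and "\<forall>T\<in>seqs V. h T \<ge> 0"
  shows "robust_opt V h k \<tau> \<ge> 0"
    and "\<exists>S\<in>seqs V. length S \<le> k \<and>
      (\<forall>V'. V' \<subseteq> set S \<longrightarrow> card V' \<le> \<tau> \<longrightarrow> robust_opt V h k \<tau> \<le> h (seq_delete S V'))"
proof -
  let ?F = "\<lambda>S. {h (seq_delete S V') |V'. V' \<subseteq> set S \<and> card V' \<le> \<tau>}"
  let ?M = "{Min (?F S) |S. S \<in> seqs V \<and> length S \<le> k}"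
  have F: "finite (?F S)" for S :: "'a list"
    by simp
  have F_ne: "?F S \<noteq> {}" for S :: "'a list"
    by (auto intro!: exI[of _ "{}"])
  have "finite ?M" using finite_seqs[OF assms(1)] by simp
  moreover have "?M \<noteq> {}" by (auto simp: seqs_def intro!: exI[of _ "[]"])
  ultimately have "robust_opt V h k \<tau> \<in> ?M"
    unfolding robust_opt_def by (rule Max_in)
  then obtain S where S: "S \<in> seqs V" "length S \<le> k" and opt: "robust_opt V h k \<tau> = Min (?F S)"
    by blast
  have "Min (?F S) \<in> ?F S" using F F_ne by (rule Min_in)
  then show "robust_opt V h k \<tau> \<ge> 0"
    using assms(2) seq_delete_in_seqs[OF S(1)] unfolding opt by fastforce
  have "robust_opt V h k \<tau> \<le> h (seq_delete S V')" if "V' \<subseteq> set S" "card V' \<le> \<tau>" for V'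
    unfolding opt using that by (intro Min_le F) blast
  then show "\<exists>S\<in>seqs V. length S \<le> k \<and>
      (\<forall>V'. V' \<subseteq> set S \<longrightarrow> card V' \<le> \<tau> \<longrightarrow> robust_opt V h k \<tau> \<le> h (seq_delete S V'))"
    using S by blast
qed

text \<open>Supplies the competitor for the second greedy run, which must avoid the elements
  \<open>U\<close> of the first. It is what remains of an optimal sequence after an admissible
  deletion that covers \<open>U\<close>.\<close>

lemma robust_opt_witness:
  assumes "finite V" and "\<forall>T\<in>seqs V. h T \<ge> 0" and U: "finite U" "card U \<le> \<tau>" and "\<tau> \<le> k"
  shows "\<exists>T\<in>seqs V. set T \<inter> U = {} \<and> length T \<le> k - \<tau> \<and> robust_opt V h k \<tau> \<le> h T"
proof -
  obtain S where S: "S \<in> seqs V" "length S \<le> k"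
    and opt: "\<And>V'. V' \<subseteq> set S \<Longrightarrow> card V' \<le> \<tau> \<Longrightarrow> robust_opt V h k \<tau> \<le> h (seq_delete S V')"
    using robust_opt_attained(2)[OF assms(1,2)] by metis
  have d: "distinct S" using S by (simp add: seqs_def)
  have len: "length (seq_delete S V') = length S - card V'" if "V' \<subseteq> set S" for V'
  proof -
    have "length (seq_delete S V') = card (set (seq_delete S V'))"
      using d distinct_card[of "seq_delete S V'"] by (simp add: seq_delete_def)
    also have "set (seq_delete S V') = set S - V'" by (auto simp: seq_delete_def)
    finally show ?thesis
      using that d by (simp add: card_Diff_subset finite_subset distinct_card)
  qed
  have "card (set S \<inter> U) \<le> card U" using U by (intro card_mono) auto
  then have card: "card (set S \<inter> U) \<le> min \<tau> (length S)"
    using U d card_mono[of "set S" "set S \<inter> U"] by (auto simp: distinct_card)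
  \<comment> \<open>Deleting \<open>set S \<inter> U\<close> alone may leave more than
    \<open>k - \<tau>\<close> elements, so the deleted set is padded to the largest admissible size;
    the minimum handles sequences shorter than \<open>\<tau>\<close>.\<close>
  obtain V' where V': "set S \<inter> U \<subseteq> V'" "V' \<subseteq> set S" "card V' = min \<tau> (length S)"
    using exists_subset_between[OF card, of "set S"] d by (auto simp: distinct_card)
  have "length (seq_delete S V') \<le> k - \<tau>" using len[OF V'(2)] V'(3) S by auto
  moreover have "set (seq_delete S V') \<inter> U = {}" using V' by (auto simp: seq_delete_def)
  ultimately show ?thesis
    using opt[OF V'(2)] V'(3) seq_delete_in_seqs[OF S(1), of V'] by auto
qed

section \<open>Removing a block from a sequence\<close>

text \<open>By distinctness no element of the block occurs elsewhere, so filtering by value agrees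
  with cutting out positions.\<close>

lemma seq_delete_consecutive:
  assumes "distinct S" "i + n \<le> length S"
  shows "seq_delete S ((\<lambda>j. S ! j) ` {i..<i + n}) = take i S @ drop (i + n) S"
proof -
  define W where "W = take n (drop i S)"
  have Z: "(\<lambda>j. S ! j) ` {i..<i + n} = set W"
  proof -
    have "set W = (\<lambda>j. drop i S ! j) ` {0..<n}"
      using assms by (simp add: W_def nth_image[symmetric] atLeast0LessThan)
    also have "\<dots> = (\<lambda>j. S ! (i + j)) ` {0..<n}" using assms by (intro image_cong) auto
    also have "\<dots> = (\<lambda>j. S ! j) ` {i..<i + n}"
      using image_image[of "\<lambda>j. S ! j" "(+) i" "{0..<n}"] by (simp add: add.commute)
    finally show ?thesis by simp
  qed
  have S: "S = take i S @ W @ drop (i + n) S"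
    by (metis W_def append_take_drop_id drop_drop add.commute)
  have "distinct (take i S @ W @ drop (i + n) S)" using assms(1) S by simp
  then have "filter (\<lambda>x. x \<notin> set W) (take i S @ W @ drop (i + n) S) = take i S @ drop (i + n) S"
    by (auto simp: filter_id_conv filter_empty_conv intro!: arg_cong2[of _ _ _ _ "(@)"])
  then show ?thesis unfolding Z seq_delete_def using S by simp
qed

text \<open>Submodularity for the prefix pairs \<open>Q\<close>, \<open>Q @ W\<close> and
  \<open>[]\<close>, \<open>Q\<close>. Together the estimates bound what deleting \<open>W\<close>
  costs in terms of \<open>h W\<close>.\<close>

lemma sequence_submodular_delete_middle:
  assumes sub: "sequence_submodular V h \<mu>" and QWR: "Q @ W @ R \<in> seqs V"
  shows "\<mu> * (h (Q @ W @ R) - h (Q @ W)) \<le> h (Q @ R) - h Q"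
    and "\<mu> * (h (Q @ W) - h Q) \<le> h W - h []"
proof -
  have in_seqs: "Q \<in> seqs V" "W \<in> seqs V" "R \<in> seqs V" "Q @ W \<in> seqs V" "[] \<in> seqs V"
    using QWR by (auto simp: seqs_def)
  have plus: "Q \<oplus> W = Q @ W" "Q \<oplus> R = Q @ R" "(Q @ W) \<oplus> R = Q @ W @ R"
    using QWR by (subst seq_plus_disjoint; auto simp: seqs_def)+
  have "seq_preceq V Q (Q @ W)" "seq_preceq V [] Q"
    unfolding seq_preceq_def using in_seqs plus(1) by (metis, simp)
  then have "marginal h R Q \<ge> \<mu> * marginal h R (Q @ W)"
    and "marginal h W [] \<ge> \<mu> * marginal h W Q"
    using sub in_seqs by (auto simp: sequence_submodular_def)
  then show "\<mu> * (h (Q @ W @ R) - h (Q @ W)) \<le> h (Q @ R) - h Q"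
    and "\<mu> * (h (Q @ W) - h Q) \<le> h W - h []"
    by (simp_all add: marginal_def plus)
qed

section \<open>Shape of the surviving sequence\<close>

text \<open>Here \<open>U\<close> is the set of the first run and \<open>Q @ W @ R\<close> the
  second run. The surviving sequence is worth at least \<open>h P\<close> by forward monotonicity,
  which controls \<open>h W\<close>, and at least \<open>\<alpha> * h (Q @ R)\<close> by backward
  monotonicity.\<close>

lemma (in monotone_objective) algorithm_decomposition:
  assumes tau: "\<tau> \<le> k" and alg: "algorithm_output V h k \<tau> S"
    and Z: "card Z = \<tau>" "consecutive_in S Z"
  obtains U Q W R where "finite U" "card U \<le> \<tau>"
    "greedy_state V h U (k - \<tau>) (Q @ W @ R)" "length (Q @ W @ R) = k - \<tau>" "length W \<le> \<tau>"
    "\<alpha> * (1 - exp (- \<mu>)) * h W \<le> h (seq_delete S Z)" "\<alpha> * h (Q @ R) \<le> h (seq_delete S Z)"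
proof -
  obtain S1 S2 where g1: "greedy_state V h {} \<tau> S1" and l1: "length S1 \<ge> \<tau>"
    and g2: "greedy_state V h (set S1) (k - \<tau>) S2" and l2: "length S2 \<ge> k - \<tau>"
    and S: "S = S1 \<oplus> S2"
    using alg by (auto simp: algorithm_output_def greedy_result_def)
  have S1: "S1 \<in> seqs V" "length S1 = \<tau>"
    using greedy_state_seqs[OF g1] l1 by auto
  have S2: "S2 \<in> seqs V" "length S2 = k - \<tau>" "set S2 \<inter> set S1 = {}"
    using greedy_state_seqs[OF g2] l2 by auto
  have SS: "S = S1 @ S2" using S S2 seq_plus_disjoint[of S1 S2] by auto
  have dS: "distinct S" using SS S1 S2 by (auto simp: seqs_def)
  obtain i where i: "i + \<tau> \<le> length S" and Zi: "Z = (\<lambda>j. S ! j) ` {i..<i + \<tau>}"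
    using Z by (auto simp: consecutive_in_def)
  have ik: "i \<le> k - \<tau>" using i SS S1 S2 by simp
  \<comment> \<open>Truncated subtraction covers both positions of the block: for
    \<open>i \<le> \<tau>\<close> the part \<open>Q\<close> is empty and \<open>W\<close> is the
    first \<open>i\<close> elements of \<open>S2\<close>; for \<open>i > \<tau>\<close> the part
    \<open>P\<close> is all of \<open>S1\<close>.\<close>
  define P Q W R where "P = take i S1" and "Q = take (i - \<tau>) S2"
    and "W = drop (i - \<tau>) (take i S2)" and "R = drop i S2"
  have QW: "Q @ W = take i S2"
    using append_take_drop_id[of "i - \<tau>" "take i S2"]
    by (simp add: Q_def W_def min_def del: append_take_drop_id)
  then have S2_eq: "S2 = Q @ W @ R" by (metis R_def append.assoc append_take_drop_id)
  have len: "length W = min i \<tau>" "length P = min i \<tau>"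
    using ik S1 S2 by (auto simp: W_def P_def)
  have "seq_delete S Z = take i S @ drop (i + \<tau>) S"
    unfolding Zi using dS i by (rule seq_delete_consecutive)
  also have "\<dots> = P @ Q @ R" using S1 by (simp add: SS P_def Q_def R_def)
  finally have del: "seq_delete S Z = P @ Q @ R" .
  have dis: "set P \<inter> set (Q @ R) = {}"
    using S2(3) S2_eq set_take_subset[of i S1] unfolding P_def by fastforce
  have PV: "P \<in> seqs V" using S1 set_take_subset[of i S1] by (auto simp: P_def seqs_def)
  have V: "Q @ R \<in> seqs V" "W \<in> seqs V"
    using S2(1) S2_eq by (auto simp: seqs_def)
  have plus: "seq_delete S Z = P \<oplus> (Q @ R)"
    using del seq_plus_disjoint[OF dis] by simp
  have HP: "h P \<le> h (seq_delete S Z)" unfolding plus using PV V by (intro forward)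
  have "\<alpha> * (1 - exp (- \<mu>)) * h W \<le> h P"
  proof (cases "W = []")
    case True
    then show ?thesis using nonneg[OF PV] by (simp add: h_Nil)
  next
    case False
    \<comment> \<open>The competitor \<open>W\<close> and the prefix \<open>P\<close> have the same
      length \<open>min i \<tau>\<close>, so the decay exponent is exactly
      \<open>- \<mu>\<close>.\<close>
    then have "1 \<le> min i \<tau>" using len by (cases W) auto
    then have "(1 - exp (- \<mu>)) * (\<alpha> * h W) \<le> h (take (min i \<tau>) S1)"
      using greedy_growth[OF g1 V(2) _ _ _ order_refl, of "min i \<tau>" 0 "min i \<tau>"] len S1
      by (simp add: h_Nil)
    moreover have "take (min i \<tau>) S1 = P" using S1 by (simp add: P_def min_def)
    ultimately show ?thesis by (simp add: mult_ac)
  qed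
  then have "\<alpha> * (1 - exp (- \<mu>)) * h W \<le> h (seq_delete S Z)" using HP by linarith
  moreover have "\<alpha> * h (Q @ R) \<le> h (seq_delete S Z)"
    unfolding plus using PV V by (intro backward)
  moreover have "card (set S1) \<le> \<tau>" using S1 card_length[of S1] by simp
  ultimately show ?thesis
    using that[of "set S1" Q W R] g2 S2 S2_eq len by simp
qed

section \<open>Two bounds against the robust optimum\<close>

text \<open>The second run reaches the fraction \<open>c\<close> of \<open>\<alpha> * OPT\<close>,
  and submodularity gives \<open>\<mu>2 * h (Q @ W @ R) \<le> h (Q @ R) + h W\<close>. Multiplying
  by \<open>\<alpha> * c\<close> makes both summands comparable with the surviving value.\<close>

lemma (in monotone_objective) approx_backward_monotone_bound:
  assumes fin: "finite V" and tau: "\<tau> < k"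
    and mu2: "0 < \<mu>2" "\<mu>2 \<le> 1" and sub: "sequence_submodular V h \<mu>2"
    and alg: "algorithm_output V h k \<tau> S"
    and Z: "card Z = \<tau>" "consecutive_in S Z"
  defines "c \<equiv> 1 - exp (- \<mu>)"
  shows "\<alpha>\<^sup>2 * \<mu>2 * c\<^sup>2 * robust_opt V h k \<tau> \<le> (1 + c) * h (seq_delete S Z)"
proof -
  define H OPT where "H = h (seq_delete S Z)" and "OPT = robust_opt V h k \<tau>"
  obtain U Q W R where U: "finite U" "card U \<le> \<tau>"
    and g: "greedy_state V h U (k - \<tau>) (Q @ W @ R)" and len: "length (Q @ W @ R) = k - \<tau>"
    and HW: "\<alpha> * c * h W \<le> H" and HQR: "\<alpha> * h (Q @ R) \<le> H"
    using algorithm_decomposition[OF less_imp_le[OF tau] alg Z]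
    unfolding c_def H_def by metis
  obtain T where T: "T \<in> seqs V" "set T \<inter> U = {}" "length T \<le> k - \<tau>" "OPT \<le> h T"
    using robust_opt_witness[OF fin _ U less_imp_le[OF tau], of h] nonneg
    unfolding OPT_def by blast
  have c: "0 < c" using mu by (simp add: c_def)
  have QWR: "Q @ W @ R \<in> seqs V" using greedy_state_seqs[OF g] by simp
  have Q: "0 \<le> h Q" using QWR by (intro nonneg) (auto simp: seqs_def)
  have "\<alpha> * OPT \<le> \<alpha> * h T" using T alpha by (intro mult_left_mono) auto
  then have "c * (\<alpha> * OPT) \<le> h (Q @ W @ R)"
    using greedy_growth[OF g T(1,2,3), of "\<alpha> * OPT" 0 "k - \<tau>"] len tau
    by (simp add: h_Nil c_def)
  then have "\<mu>2 * (c * (\<alpha> * OPT)) \<le> \<mu>2 * h (Q @ W @ R)"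
    using mu2 by (intro mult_left_mono) auto
  also have "\<dots> = \<mu>2 * (h (Q @ W @ R) - h (Q @ W)) + \<mu>2 * (h (Q @ W) - h Q) + \<mu>2 * h Q"
    by (simp add: algebra_simps)
  also have "\<dots> \<le> (h (Q @ R) - h Q) + (h W - h []) + h Q"
    using sequence_submodular_delete_middle[OF sub QWR] mult_right_mono[OF mu2(2) Q]
    by linarith
  also have "\<dots> = h (Q @ R) + h W" by (simp add: h_Nil)
  finally have "\<alpha> * c * (\<mu>2 * (c * (\<alpha> * OPT))) \<le> \<alpha> * c * (h (Q @ R) + h W)"
    using alpha c by (intro mult_left_mono) auto
  also have "\<dots> = c * (\<alpha> * h (Q @ R)) + \<alpha> * c * h W" by (simp add: algebra_simps)
  also have "\<dots> \<le> c * H + H" using HW HQR c by (intro add_mono mult_left_mono) auto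
  finally show ?thesis unfolding H_def OPT_def by (simp add: algebra_simps power2_eq_square)
qed

text \<open>Progress on \<open>Q\<close> and on \<open>R\<close> is measured separately. Since
  \<open>W\<close> reduces only the progress credited to \<open>R\<close>, its value enters with
  weight \<open>1 - y\<close> instead of 1, which is the gain over the cruder splitting.\<close>

lemma (in monotone_objective) backward_monotone_bound:
  assumes fin: "finite V" and tau: "2 * \<tau> < k" and alpha1: "\<alpha> = 1"
    and mu2: "0 < \<mu>2" "\<mu>2 \<le> 1" and sub: "sequence_submodular V h \<mu>2"
    and alg: "algorithm_output V h k \<tau> S"
    and Z: "card Z = \<tau>" "consecutive_in S Z"
  defines "c \<equiv> 1 - exp (- \<mu>)"
    and "u \<equiv> 1 - exp (- (\<mu> * ((real k - 2 * real \<tau>) / (real k - real \<tau>))))"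
  shows "c * \<mu>2 * u * robust_opt V h k \<tau> \<le> (c + u) * h (seq_delete S Z)"
proof -
  define H OPT where "H = h (seq_delete S Z)" and "OPT = robust_opt V h k \<tau>"
  define m where "m = k - \<tau>"
  have tk: "\<tau> \<le> k" and m: "1 \<le> m" "real m = real k - real \<tau>" using tau by (auto simp: m_def)
  obtain U Q W R where U: "finite U" "card U \<le> \<tau>"
    and g: "greedy_state V h U m (Q @ W @ R)" and len: "length (Q @ W @ R) = m"
    and W: "length W \<le> \<tau>" and HW: "c * h W \<le> H" and HQR: "h (Q @ R) \<le> H"
    using algorithm_decomposition[OF tk alg Z]
    unfolding c_def H_def alpha1 mult_1 m_def by metis
  obtain T where T: "T \<in> seqs V" "set T \<inter> U = {}" "length T \<le> m" "OPT \<le> h T"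
    using robust_opt_witness[OF fin _ U tk, of h] nonneg
    unfolding OPT_def m_def by blast
  have OPT: "0 \<le> OPT" using robust_opt_attained(1)[OF fin, of h] nonneg by (simp add: OPT_def)
  have L: "OPT \<le> \<alpha> * h T" using T alpha1 by simp
  have c: "0 < c" using mu by (simp add: c_def)
  have QWR: "Q @ W @ R \<in> seqs V" using greedy_state_seqs[OF g] by simp
  have "Q @ R \<in> seqs V" using QWR by (auto simp: seqs_def)
  then have H: "0 \<le> H" using HQR nonneg[of "Q @ R"] by simp
  \<comment> \<open>The factors by which the bounds on the gap to \<open>OPT\<close> shrink along
    \<open>Q\<close> and along \<open>R\<close>.\<close>
  define w y where "w = exp (- \<mu> * real (length Q) / real m)"
    and "y = exp (- \<mu> * real (length R) / real m)"
  have w: "0 < w" "w \<le> 1" and y: "0 < y" "y \<le> 1" using mu by (auto simp: w_def y_def)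
  have hQ: "(1 - w) * OPT \<le> h Q"
    using greedy_growth[OF g T(1,2,3) m(1) L, of 0 "length Q"] by (simp add: h_Nil w_def)
  have hR: "(1 - y) * (OPT - h (Q @ W)) \<le> h (Q @ W @ R) - h (Q @ W)"
    using greedy_growth[OF g T(1,2,3) m(1) L, of "length (Q @ W)" "length R"]
    by (simp add: y_def)
  \<comment> \<open>Progress of \<open>Q\<close> and \<open>R\<close> combined as if uninterrupted:
    \<open>1 - y * w = (1 - w) + w * (1 - y)\<close>.\<close>
  define u' where "u' = 1 - y * w"
  have "y * w = exp (- (\<mu> * ((real (length Q) + real (length R)) / real m)))"
    by (simp add: w_def y_def exp_add[symmetric] add_divide_distrib algebra_simps)
  also have "\<dots> \<le> exp (- (\<mu> * ((real k - 2 * real \<tau>) / real m)))"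
  proof -
    \<comment> \<open>At most \<open>\<tau>\<close> of the \<open>k - \<tau>\<close> greedy steps
      belong to \<open>W\<close>.\<close>
    have "real k - 2 * real \<tau> \<le> real (length Q) + real (length R)"
      using len W m by simp
    then show ?thesis using mu m by (simp add: divide_right_mono)
  qed
  finally have uu: "u \<le> u'" by (simp add: u_def u'_def m(2))
  have yu: "1 - y \<le> u'" using mult_left_mono[OF w(2), of y] y by (simp add: u'_def)
  have u: "0 \<le> u" using tau mu by (simp add: u_def)
  have "h Q + \<mu>2 * ((1 - y) * (OPT - h (Q @ W))) \<le> h Q + \<mu>2 * (h (Q @ W @ R) - h (Q @ W))"
    using hR mu2 by simp
  also have "\<dots> \<le> h (Q @ R)"
    using sequence_submodular_delete_middle(1)[OF sub QWR] by linarith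
  finally have *: "h Q + \<mu>2 * ((1 - y) * (OPT - h (Q @ W))) \<le> h (Q @ R)" .
  have "(1 - y) * (\<mu>2 * (h (Q @ W) - h Q)) \<le> (1 - y) * h W"
    using sequence_submodular_delete_middle(2)[OF sub QWR] y
    by (intro mult_left_mono) (auto simp: h_Nil)
  with * have "h Q * (1 - \<mu>2 * (1 - y)) + \<mu>2 * (1 - y) * OPT - (1 - y) * h W \<le> h (Q @ R)"
    by (simp add: algebra_simps)
  \<comment> \<open>The coefficient of \<open>h Q\<close> is nonnegative, so its lower bound may be
    inserted.\<close>
  moreover have "(1 - w) * OPT * (1 - \<mu>2 * (1 - y)) \<le> h Q * (1 - \<mu>2 * (1 - y))"
    using hQ mu2 y mult_mono[of \<mu>2 1 "1 - y" 1] by (intro mult_right_mono) auto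
  moreover have "\<mu>2 * u' * OPT \<le> (1 - w) * OPT * (1 - \<mu>2 * (1 - y)) + \<mu>2 * (1 - y) * OPT"
  proof -
    \<comment> \<open>This product is exactly the difference of the two sides.\<close>
    have "0 \<le> (1 - \<mu>2) * ((1 - w) * OPT)" using mu2 w OPT by simp
    then show ?thesis by (simp add: u'_def algebra_simps)
  qed
  ultimately have "\<mu>2 * u' * OPT \<le> H + (1 - y) * h W" using HQR by linarith
  then have "c * (\<mu>2 * u' * OPT) \<le> c * (H + (1 - y) * h W)"
    using c by (intro mult_left_mono) auto
  also have "\<dots> = c * H + (1 - y) * (c * h W)" by (simp add: algebra_simps)
  also have "\<dots> \<le> c * H + (1 - y) * H" using HW y by (simp add: mult_left_mono)
  also have "\<dots> \<le> (c + u') * H" using mult_right_mono[OF yu H] by (simp add: algebra_simps)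
  finally have main: "c * (\<mu>2 * u' * OPT) \<le> (c + u') * H" .
  \<comment> \<open>the bound is increasing in the amount of greedy progress, so \<open>u'\<close> may be lowered to \<open>u\<close>\<close>
  show ?thesis
  proof (cases "u' = 0")
    case True
    then have "u = 0" using u uu by simp
    then show ?thesis using c H by (simp add: H_def)
  next
    case False
    then have u': "0 < u'" using u uu by simp
    have "u' * (c * \<mu>2 * u * OPT) = u * (c * (\<mu>2 * u' * OPT))" by (simp add: algebra_simps)
    also have "\<dots> \<le> u * ((c + u') * H)" using main u by (intro mult_left_mono)
    also have "\<dots> = u * c * H + u * u' * H" by (simp add: algebra_simps)
    also have "\<dots> \<le> u' * c * H + u * u' * H"
      using uu u' c H by (intro add_mono mult_right_mono) auto
    also have "\<dots> = u' * ((c + u) * H)" by (simp add: algebra_simps)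
    finally show ?thesis using u' by (simp add: H_def OPT_def)
  qed
qed

section \<open>Passage to the stated constants\<close>

text \<open>When \<open>2 * \<tau> > k\<close>, \<open>b\<close> is negative and the denominator in
  (i) may be negative too, making the quotient of two negative numbers positive. The positivity
  premise on the denominator excludes this.\<close>

theorem theorem5:
  fixes V :: "'a set" and h :: "'a list \<Rightarrow> real" and k \<tau> :: nat
    and \<mu>1 \<mu>2 \<alpha> :: real and S :: "'a list" and Z :: "'a set"
  assumes "finite V" and "k \<ge> 2" and "1 \<le> \<tau>" and "\<tau> \<le> k" and "card V \<ge> k"
    and "\<mu>1 \<in> {0<..1}" and "\<mu>2 \<in> {0<..1}" and "\<alpha> \<in> {0<..1}"
    and "\<forall>T\<in>seqs V. h T \<ge> 0" and "h [] = 0" and "forward_monotone V h"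
    and "algorithm_output V h k \<tau> S"
    and "Z \<subseteq> set S" and "card Z = \<tau>" and "consecutive_in S Z"
  shows
    "(let a = \<mu>1 * (1 - 1 / exp \<mu>1);
          b = \<mu>1 * ((real k - 2 * real \<tau>) / (real k - real \<tau>))
      in \<tau> < k \<longrightarrow> backward_monotone V h \<longrightarrow> element_sequence_submodular V h \<mu>1 \<longrightarrow>
         sequence_submodular V h \<mu>2 \<longrightarrow> (a + 1) * exp b - a * \<mu>2 > 0 \<longrightarrow>
         h (seq_delete S Z) \<ge>
           (a * \<mu>2 * (exp b - 1)) / ((a + 1) * exp b - a * \<mu>2) * robust_opt V h k \<tau>)
     \<and>
     (approx_backward_monotone V h \<alpha> \<longrightarrow> element_sequence_submodular V h \<mu>1 \<longrightarrow>
      sequence_submodular V h \<mu>2 \<longrightarrow>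
        h (seq_delete S Z) \<ge>
          (\<alpha>\<^sup>2 * \<mu>1 * \<mu>2 * (exp \<mu>1 - 1)\<^sup>2)
            / (\<mu>1 * exp \<mu>1 * (exp \<mu>1 - 1) + exp (2 * \<mu>1)) * robust_opt V h k \<tau>)"
proof -
  have mu1: "0 < \<mu>1" "\<mu>1 \<le> 1" and mu2: "0 < \<mu>2" "\<mu>2 \<le> 1" and al: "0 < \<alpha>" "\<alpha> \<le> 1"
    using assms by auto
  define OPT H where "OPT = robust_opt V h k \<tau>" and "H = h (seq_delete S Z)"
  have OPT: "0 \<le> OPT" unfolding OPT_def using assms(1,9) by (rule robust_opt_attained)
  have S: "S \<in> seqs V"
    using assms(12) greedy_state_seqs seq_plus_in_seqs
    by (metis algorithm_output_def greedy_result_def)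
  have H: "0 \<le> H" unfolding H_def using assms(9) seq_delete_in_seqs[OF S] by blast
  define c where "c = 1 - exp (- \<mu>1)"
  have c: "0 < c" "c \<le> 1" using mu1 by (auto simp: c_def)
  have c': "1 - 1 / exp \<mu>1 = c" by (simp add: c_def exp_minus inverse_eq_divide)
  \<comment> \<open>Instantiated with \<open>\<beta> = 1\<close> for (i) and
    \<open>\<beta> = \<alpha>\<close> for (ii).\<close>
  have objective: "monotone_objective V h \<mu>1 \<beta>"
    if "approx_backward_monotone V h \<beta>" "element_sequence_submodular V h \<mu>1" "0 < \<beta>" "\<beta> \<le> 1" for \<beta>
    using that mu1 assms(9,10,11)
    by unfold_locales (auto simp: forward_monotone_def approx_backward_monotone_def)

  have part1: "(a * \<mu>2 * (exp b - 1)) / ((a + 1) * exp b - a * \<mu>2) * OPT \<le> H"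
    if a: "a = \<mu>1 * c" and b: "b = \<mu>1 * ((real k - 2 * real \<tau>) / (real k - real \<tau>))"
      and t: "\<tau> < k" and bm: "backward_monotone V h" and es: "element_sequence_submodular V h \<mu>1"
      and ss: "sequence_submodular V h \<mu>2" and den: "(a + 1) * exp b - a * \<mu>2 > 0" for a b
  \<comment> \<open>Otherwise \<open>b \<le> 0\<close>, the claimed factor is nonpositive, and
    nonnegativity of \<open>H\<close> is enough.\<close>
  proof (cases "2 * \<tau> < k")
    case False
    then have "b \<le> 0" unfolding b using mu1 t
      by (intro mult_nonneg_nonpos divide_nonpos_nonneg) auto
    then have "a * \<mu>2 * (exp b - 1) \<le> 0"
      using a mu1 mu2 c by (intro mult_nonneg_nonpos) auto
    then have "(a * \<mu>2 * (exp b - 1)) / ((a + 1) * exp b - a * \<mu>2) * OPT \<le> 0"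
      using den OPT mult_nonpos_nonneg[OF divide_nonpos_pos] by blast
    then show ?thesis using H by linarith
  next
    case True
    interpret monotone_objective V h \<mu>1 1
      using objective[of 1] bm es by (simp add: approx_backward_monotone_def backward_monotone_def)
    define u where "u = 1 - exp (- b)"
    have bound: "c * \<mu>2 * u * OPT \<le> (c + u) * H"
      unfolding u_def OPT_def H_def b c_def
      by (rule backward_monotone_bound[OF assms(1) True refl mu2 ss assms(12,14,15)])
    have "0 \<le> b" using True mu1 by (simp add: b)
    then have u: "0 \<le> u" "u \<le> 1" by (auto simp: u_def)
    \<comment> \<open>The stated denominator divided by \<open>exp b\<close>, since
      \<open>1 - u = exp (- b)\<close>; the factor becomes
      \<open>a * \<mu>2 * u / D\<close>.\<close>
    define D where "D = a + 1 - a * \<mu>2 * (1 - u)"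
    have eb: "exp b * (1 - u) = 1" by (simp add: u_def exp_minus)
    have "exp b * D = (a + 1) * exp b - a * \<mu>2 * (exp b * (1 - u))"
      by (simp add: D_def algebra_simps)
    then have D: "exp b * D = (a + 1) * exp b - a * \<mu>2" by (simp add: eb)
    have "a * \<mu>2 * (exp b - exp b * (1 - u)) = exp b * (a * \<mu>2 * u)"
      by (simp add: algebra_simps)
    then have N: "a * \<mu>2 * (exp b - 1) = exp b * (a * \<mu>2 * u)" by (simp add: eb)
    have D0: "0 < D" using den D by (metis exp_gt_zero zero_less_mult_pos)
    \<comment> \<open>A convex combination of \<open>\<mu>1\<close> and \<open>a * \<mu>2\<close>,
      neither above \<open>\<mu>1\<close>. It yields \<open>\<mu>1 * (c + u) \<le> D\<close>, so the
      stated factor follows from \<open>bound\<close>.\<close>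
    have "\<mu>1 * u + a * \<mu>2 * (1 - u) \<le> 1"
    proof -
      have "a * \<mu>2 \<le> \<mu>1"
        using mult_mono[of "\<mu>1 * c" \<mu>1 \<mu>2 1] mult_left_mono[OF c(2), of \<mu>1] a mu1 mu2 c by simp
      then have "a * \<mu>2 * (1 - u) \<le> \<mu>1 * (1 - u)" using u by (intro mult_right_mono) auto
      then show ?thesis using mu1 by (simp add: algebra_simps)
    qed
    then have "a + \<mu>1 * u \<le> D" by (simp add: D_def)
    then have aD: "\<mu>1 * (c + u) \<le> D" by (simp add: a algebra_simps)
    have "a * \<mu>2 * u * OPT = \<mu>1 * (c * \<mu>2 * u * OPT)" by (simp add: a)
    also have "\<dots> \<le> \<mu>1 * ((c + u) * H)" using bound mu1 by (intro mult_left_mono) auto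
    also have "\<dots> \<le> D * H" using mult_right_mono[OF aD H] by (simp add: mult.assoc)
    finally have "a * \<mu>2 * u / D * OPT \<le> H" using D0 by (simp add: field_simps)
    then show ?thesis unfolding N D[symmetric] by simp
  qed

  have part2: "(\<alpha>\<^sup>2 * \<mu>1 * \<mu>2 * (exp \<mu>1 - 1)\<^sup>2)
      / (\<mu>1 * exp \<mu>1 * (exp \<mu>1 - 1) + exp (2 * \<mu>1)) * OPT \<le> H"
    if ab: "approx_backward_monotone V h \<alpha>" and es: "element_sequence_submodular V h \<mu>1"
      and ss: "sequence_submodular V h \<mu>2"
  proof -
    interpret monotone_objective V h \<mu>1 \<alpha>
      using objective[of \<alpha>] ab es al by simp
    have bound: "\<alpha>\<^sup>2 * \<mu>2 * c\<^sup>2 * OPT \<le> (1 + c) * H"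
    proof (cases "\<tau> < k")
      case True
      show ?thesis unfolding OPT_def H_def c_def
        by (rule approx_backward_monotone_bound[OF assms(1) True mu2 ss assms(12,14,15)])
    next
      \<comment> \<open>With \<open>\<tau> = k\<close> the competitor is empty, so the optimum
        vanishes.\<close>
      case False
      then have "\<tau> = k" using assms(4) by simp
      then have "OPT \<le> h []"
        using robust_opt_witness[OF assms(1,9), of "{}" \<tau> k] by (auto simp: OPT_def)
      then have "OPT = 0" using OPT assms(10) by simp
      then show ?thesis using c H by simp
    qed
    \<comment> \<open>Exposes the factor \<open>(exp \<mu>1)\<^sup>2\<close> common to numerator and
      denominator.\<close>
    have E: "exp \<mu>1 - 1 = exp \<mu>1 * c" by (simp add: c_def exp_minus algebra_simps)
    have E2: "exp (2 * \<mu>1) = (exp \<mu>1)\<^sup>2"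
      by (simp add: power2_eq_square exp_add[symmetric])
    have "(\<alpha>\<^sup>2 * \<mu>1 * \<mu>2 * (exp \<mu>1 - 1)\<^sup>2) / (\<mu>1 * exp \<mu>1 * (exp \<mu>1 - 1) + exp (2 * \<mu>1))
        = ((exp \<mu>1)\<^sup>2 * (\<alpha>\<^sup>2 * \<mu>1 * \<mu>2 * c\<^sup>2)) / ((exp \<mu>1)\<^sup>2 * (\<mu>1 * c + 1))"
      unfolding E E2 by (simp add: power2_eq_square algebra_simps)
    also have "\<dots> = \<alpha>\<^sup>2 * \<mu>1 * \<mu>2 * c\<^sup>2 / (\<mu>1 * c + 1)" by simp
    finally have eq: "(\<alpha>\<^sup>2 * \<mu>1 * \<mu>2 * (exp \<mu>1 - 1)\<^sup>2)
        / (\<mu>1 * exp \<mu>1 * (exp \<mu>1 - 1) + exp (2 * \<mu>1)) = \<alpha>\<^sup>2 * \<mu>1 * \<mu>2 * c\<^sup>2 / (\<mu>1 * c + 1)" .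
    have "\<alpha>\<^sup>2 * \<mu>1 * \<mu>2 * c\<^sup>2 * OPT = \<mu>1 * (\<alpha>\<^sup>2 * \<mu>2 * c\<^sup>2 * OPT)" by simp
    also have "\<dots> \<le> \<mu>1 * ((1 + c) * H)" using bound mu1 by (intro mult_left_mono) auto
    \<comment> \<open>Uses \<open>\<mu>1 * (1 + c) \<le> \<mu>1 * c + 1\<close>, that is,
      \<open>\<mu>1 \<le> 1\<close>.\<close>
    also have "\<dots> \<le> (\<mu>1 * c + 1) * H"
      using mult_right_mono[OF mu1(2) H] by (simp add: algebra_simps)
    finally have "\<alpha>\<^sup>2 * \<mu>1 * \<mu>2 * c\<^sup>2 * OPT \<le> (\<mu>1 * c + 1) * H" .
    moreover have "0 < \<mu>1 * c + 1" using mu1 c by (simp add: add_pos_pos)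
    ultimately have "\<alpha>\<^sup>2 * \<mu>1 * \<mu>2 * c\<^sup>2 / (\<mu>1 * c + 1) * OPT \<le> H"
      by (simp add: pos_divide_le_eq mult.commute)
    then show ?thesis unfolding eq .
  qed

  show ?thesis
    using part1[OF refl refl] part2
    unfolding Let_def c' OPT_def H_def by blast
qed

end
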